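(* Let $X$ be a nonempty separable metric space. Then $$2d_{GH}\Bigl(X,\ (l^\infty)\prod_{n=1}^\infty X\Bigr)=\operatorname{diam}(X).$$
   Context: $\operatorname{diam}(X)=\sup_{x,y\in X}d_X(x,y)\in[0,\infty]$. A correspondence between $X$ and $Y$ is a subset $R\subset X\times Y$ whose projections to $X$ and to $Y$ are surjective; its distortion is $\operatorname{dis}R=\sup\{|d_X(x,x')-d_Y(y,y')| : (x,y),(x',y')\in R\}$. The Gromov--Hausdorff distance is $d_{GH}(X,Y)=\frac12\inf\{\operatorname{dis}R: R\text{ a correspondence between }X\text{ and }Y\}\in[0,\infty]$. $(l^\infty)\prod_{n=1}^\infty X$ is the set of all sequences in $X$ with distance $d(\{x_n\},\{y_n\})=\sup_nd_X(x_n,y_n)$. When $X$ is unbounded this distance is allowed to take the value $+\infty$, and $d_{GH}$ is defined by the same formula. *)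

theory Defs
  imports "HOL-Analysis.Analysis"
begin

text \<open>
  A space is a carrier set together with a distance function with values in
  \<open>[0,\<infinity>]\<close>, since the sup-distance on sequences may be infinite.
\<close>

definition ediam :: "'a set \<Rightarrow> ('a \<Rightarrow> 'a \<Rightarrow> ennreal) \<Rightarrow> ennreal" where
  "ediam X dX = (SUP (x, y)\<in>X \<times> X. dX x y)"

definition correspondence :: "'a set \<Rightarrow> 'b set \<Rightarrow> ('a \<times> 'b) set \<Rightarrow> bool" where
  "correspondence X Y R \<longleftrightarrow> R \<subseteq> X \<times> Y \<and> fst ` R = X \<and> snd ` R = Y"

text \<open>
  The absolute difference \<open>|a - b|\<close> on \<open>[0,\<infinity>]\<close>: subtraction on \<^typ>\<open>ennreal\<close> is truncated
  at 0, so the maximum picks the nonnegative difference. Because \<open>\<infinity> - \<infinity> = \<infinity>\<close> in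
  \<^typ>\<open>ennreal\<close>, the case \<open>a = b\<close> is separated to obtain \<open>|\<infinity> - \<infinity>| = 0\<close>; this only
  matters when both spaces have infinite distances.
\<close>

definition ennreal_absdiff :: "ennreal \<Rightarrow> ennreal \<Rightarrow> ennreal" where
  "ennreal_absdiff a b = (if a = b then 0 else max (a - b) (b - a))"

lemma ennreal_absdiff_ennreal:
  assumes "0 \<le> a" "0 \<le> b"
  shows "ennreal_absdiff (ennreal a) (ennreal b) = ennreal \<bar>a - b\<bar>"
  using assms
  by (cases a b rule: linorder_cases)
     (auto simp: ennreal_absdiff_def ennreal_minus max_def ennreal_neg)

lemma ennreal_absdiff_top:
  "ennreal_absdiff (ennreal a) top = top" "ennreal_absdiff top (ennreal b) = top"
  by (auto simp: ennreal_absdiff_def)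

definition distortion ::
  "('a \<Rightarrow> 'a \<Rightarrow> ennreal) \<Rightarrow> ('b \<Rightarrow> 'b \<Rightarrow> ennreal) \<Rightarrow> ('a \<times> 'b) set \<Rightarrow> ennreal" where
  "distortion dX dY R =
     (SUP ((x, y), (x', y'))\<in>R \<times> R. ennreal_absdiff (dX x x') (dY y y'))"

definition GH_dist ::
  "'a set \<Rightarrow> ('a \<Rightarrow> 'a \<Rightarrow> ennreal) \<Rightarrow> 'b set \<Rightarrow> ('b \<Rightarrow> 'b \<Rightarrow> ennreal) \<Rightarrow> ennreal" where
  "GH_dist X dX Y dY = (INF R\<in>{R. correspondence X Y R}. distortion dX dY R) / 2"

definition seq_space :: "'a set \<Rightarrow> (nat \<Rightarrow> 'a) set" where
  "seq_space X = {s. \<forall>n. s n \<in> X}"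

definition linf_dist :: "('a \<Rightarrow> 'a \<Rightarrow> ennreal) \<Rightarrow> (nat \<Rightarrow> 'a) \<Rightarrow> (nat \<Rightarrow> 'a) \<Rightarrow> ennreal" where
  "linf_dist dX s t = (SUP n. dX (s n) (t n))"

end

theory Submission
  imports Defs
begin

text \<open>
  Both inequalities concern the distortion of correspondences between \<open>X\<close> and the space of
  sequences in \<open>X\<close>.

  For the upper bound, all distances in either space are bounded by the
  diameter of \<open>X\<close>, so even the full product of the two spaces, as a correspondence, has
  distortion at most that diameter (\<open>distortion_le_bound\<close>, \<open>linf_dist_le_ediam\<close>).

  For the lower bound fix distinct points \<open>p, q \<in> X\<close>. The sequences with values in \<open>{p, q}\<close> are uncountably
  many, and any two distinct ones are exactly \<open>d p q\<close> apart. A correspondence gives each of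
  them a partner in \<open>X\<close>; since \<open>X\<close> is separable, two of these uncountably many partners are
  arbitrarily close to each other (\<open>separable_family_has_close_pair\<close>). Hence the distortion is
  at least \<open>d p q - \<epsilon>\<close> for every \<open>\<epsilon> > 0\<close>, and thus at least \<open>d p q\<close>.
\<close>

lemma ennreal_absdiff_le:
  assumes "a \<le> D" "b \<le> D"
  shows "ennreal_absdiff a b \<le> D"
  using assms order_trans[OF diff_le_self_ennreal, of a D b]
    order_trans[OF diff_le_self_ennreal, of b D a]
  by (simp add: ennreal_absdiff_def)

text \<open>
  The triangle inequality on \<open>[0,\<infinity>]\<close>, through which a bound on the distortion transfers distances
  from one space to the other; it includes infinite values.
\<close>

lemma le_add_ennreal_absdiff: "b \<le> a + ennreal_absdiff a b"
proof (cases "a = b")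
  case False
  have "b \<le> a + (b - a)"
    by (auto simp: add_diff_self_ennreal)
  also have "\<dots> \<le> a + ennreal_absdiff a b"
    using False by (intro add_left_mono) (simp add: ennreal_absdiff_def)
  finally show ?thesis .
qed simp

lemma distortion_upper:
  assumes "(x, y) \<in> R" "(x', y') \<in> R"
  shows "ennreal_absdiff (dX x x') (dY y y') \<le> distortion dX dY R"
  unfolding distortion_def
  using assms by (intro SUP_upper2[of "((x, y), (x', y'))"]) auto

lemma distortion_le_bound:
  assumes "R \<subseteq> X \<times> Y"
    and "\<And>x x'. x \<in> X \<Longrightarrow> x' \<in> X \<Longrightarrow> dX x x' \<le> D"
    and "\<And>y y'. y \<in> Y \<Longrightarrow> y' \<in> Y \<Longrightarrow> dY y y' \<le> D"
  shows "distortion dX dY R \<le> D"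
  unfolding distortion_def
proof (intro SUP_least, clarify)
  fix x y x' y'
  assume "(x, y) \<in> R" "(x', y') \<in> R"
  with assms(1) have "x \<in> X" "y \<in> Y" "x' \<in> X" "y' \<in> Y"
    by auto
  then show "ennreal_absdiff (dX x x') (dY y y') \<le> D"
    by (intro ennreal_absdiff_le assms(2,3))
qed

lemma ediam_upper: "x \<in> X \<Longrightarrow> y \<in> X \<Longrightarrow> dX x y \<le> ediam X dX"
  unfolding ediam_def by (intro SUP_upper2[of "(x, y)"]) auto

lemma linf_dist_le_ediam:
  assumes "s \<in> seq_space X" "t \<in> seq_space X"
  shows "linf_dist dX s t \<le> ediam X dX"
  unfolding linf_dist_def
  using assms by (intro SUP_least ediam_upper) (auto simp: seq_space_def)

lemma correspondence_Times:
  assumes "X \<noteq> {}" "Y \<noteq> {}"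
  shows "correspondence X Y (X \<times> Y)"
  using assms by (auto simp: correspondence_def)

text \<open>
  Sending each point of the family to a nearby point of a countable dense set cannot be
  injective, because there are uncountably many sets of natural numbers; two indices with the
  same nearby point give the close pair.
\<close>

lemma separable_family_has_close_pair:
  fixes f :: "nat set \<Rightarrow> 'a"
  assumes "Metric_space X d"
    and "separable_space (Metric_space.mtopology X d)"
    and f: "\<And>A. f A \<in> X" and "\<epsilon> > 0"
  obtains A B where "A \<noteq> B" "d (f A) (f B) < \<epsilon>"
proof -
  interpret Metric_space X d by fact
  obtain C where C: "countable C" "mtopology closure_of C = X"
    using assms(2) by (auto simp: separable_space_def)
  have "\<exists>c\<in>C. c \<in> mball (f A) (\<epsilon> / 2)" for A
  proof -
    have "f A \<in> mtopology closure_of C"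
      using f C(2) by simp
    then show ?thesis
      using half_gt_zero[OF \<open>\<epsilon> > 0\<close>] unfolding metric_closure_of by blast
  qed
  then obtain c where c: "c A \<in> C" "c A \<in> mball (f A) (\<epsilon> / 2)" for A
    by metis
  have "\<not> inj c"
  proof
    assume "inj c"
    moreover have "countable (range c)"
      using C(1) c(1) by (auto intro: countable_subset[of _ C])
    ultimately have "countable (UNIV :: nat set set)"
      by (rule countable_image_inj_on[rotated])
    then have "range (from_nat_into (UNIV :: nat set set)) = Pow UNIV"
      by (simp add: range_from_nat_into)
    then show False
      using Cantors_theorem[of "UNIV :: nat set"] by blast
  qed
  then obtain A B where "A \<noteq> B" and eq: "c A = c B"
    by (auto simp: inj_def)
  have "d (f A) (f B) \<le> d (f A) (c A) + d (c A) (f B)"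
    using f c(2)[of A] by (intro triangle) auto
  also have "\<dots> < \<epsilon>"
    using c(2)[of A] c(2)[of B] by (simp add: eq commute)
  finally show thesis
    using \<open>A \<noteq> B\<close> that by blast
qed

text \<open>
  Indexing by sets \<open>A\<close> keeps the family uncountable as a family even for \<open>p = q\<close>, which spares
  a case distinction.
\<close>

definition two_valued_seq :: "'a \<Rightarrow> 'a \<Rightarrow> nat set \<Rightarrow> nat \<Rightarrow> 'a" where
  "two_valued_seq p q A n = (if n \<in> A then p else q)"

lemma two_valued_seq_in_seq_space:
  "p \<in> X \<Longrightarrow> q \<in> X \<Longrightarrow> two_valued_seq p q A \<in> seq_space X"
  by (simp add: seq_space_def two_valued_seq_def)

lemma linf_dist_two_valued_seq_ge:
  assumes "A \<noteq> B" and "dX p q = dX q p"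
  shows "dX p q \<le> linf_dist dX (two_valued_seq p q A) (two_valued_seq p q B)"
proof -
  obtain n where "(n \<in> A) \<noteq> (n \<in> B)"
    using \<open>A \<noteq> B\<close> by blast
  then have "dX (two_valued_seq p q A n) (two_valued_seq p q B n) = dX p q"
    using assms(2) by (auto simp: two_valued_seq_def)
  then show ?thesis
    unfolding linf_dist_def by (intro SUP_upper2[of n]) auto
qed

text \<open>
  Two \<open>{p, q}\<close>-valued sequences with different index sets whose partners in \<open>X\<close> are \<open>\<epsilon>\<close>-close witness a
  distortion of at least \<open>d p q - \<epsilon>\<close>. The estimate is kept in additive form because subtraction
  on \<open>ennreal\<close> is truncated.
\<close>

lemma dist_le_distortion_seq_space:
  assumes "Metric_space X d"
    and "separable_space (Metric_space.mtopology X d)"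
    and R: "correspondence X (seq_space X) R"
    and "p \<in> X" "q \<in> X"
  shows "ennreal (d p q) \<le>
    distortion (\<lambda>x y. ennreal (d x y)) (linf_dist (\<lambda>x y. ennreal (d x y))) R"
    (is "_ \<le> ?dis")
proof (rule ennreal_le_epsilon)
  interpret Metric_space X d by fact
  let ?dX = "\<lambda>x y. ennreal (d x y)"
  let ?s = "two_valued_seq p q"
  fix \<epsilon> :: real
  assume "\<epsilon> > 0"
  have "\<exists>x. (x, ?s A) \<in> R" for A
  proof -
    have "?s A \<in> snd ` R"
      using R two_valued_seq_in_seq_space[OF assms(4,5)] by (simp add: correspondence_def)
    then show ?thesis by force
  qed
  then obtain f where f: "(f A, ?s A) \<in> R" for A
    by metis
  then have "f A \<in> X" for A
    using R by (auto simp: correspondence_def)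
  then obtain A B where "A \<noteq> B" and close: "d (f A) (f B) < \<epsilon>"
    using separable_family_has_close_pair[OF assms(1,2) _ \<open>\<epsilon> > 0\<close>] by metis
  have "ennreal (d p q) \<le> linf_dist ?dX (?s A) (?s B)"
    using linf_dist_two_valued_seq_ge[OF \<open>A \<noteq> B\<close>, of ?dX p q] by (simp add: commute)
  also have "\<dots> \<le> ?dX (f A) (f B) + ennreal_absdiff (?dX (f A) (f B)) (linf_dist ?dX (?s A) (?s B))"
    by (rule le_add_ennreal_absdiff)
  also have "\<dots> \<le> ennreal \<epsilon> + ?dis"
    using close distortion_upper[OF f f, of ?dX A B "linf_dist ?dX"]
    by (intro add_mono) (auto intro: ennreal_leI)
  finally show "ennreal (d p q) \<le> ?dis + ennreal \<epsilon>"
    by (simp add: add.commute)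
qed

theorem corollary4p6:
  fixes X :: "'a set" and d :: "'a \<Rightarrow> 'a \<Rightarrow> real"
  assumes "Metric_space X d"
    and "X \<noteq> {}"
    and "separable_space (Metric_space.mtopology X d)"
  shows "2 * GH_dist X (\<lambda>x y. ennreal (d x y))
               (seq_space X) (linf_dist (\<lambda>x y. ennreal (d x y)))
         = ediam X (\<lambda>x y. ennreal (d x y))"
proof -
  let ?dX = "\<lambda>x y. ennreal (d x y)"
  let ?I = "INF R\<in>{R. correspondence X (seq_space X) R}. distortion ?dX (linf_dist ?dX) R"
  have "?I = ediam X ?dX"
  proof (rule antisym)
    have "seq_space X \<noteq> {}"
      using assms(2) by (auto simp: seq_space_def)
    then have "correspondence X (seq_space X) (X \<times> seq_space X)"
      using assms(2) by (rule correspondence_Times[rotated])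
    moreover have "distortion ?dX (linf_dist ?dX) (X \<times> seq_space X) \<le> ediam X ?dX"
      by (rule distortion_le_bound[OF order_refl])
        (auto intro: ediam_upper[where dX = ?dX] linf_dist_le_ediam)
    ultimately show "?I \<le> ediam X ?dX"
      by (intro INF_lower2) auto
    show "ediam X ?dX \<le> ?I"
      unfolding ediam_def
      using dist_le_distortion_seq_space[OF assms(1,3)]
      by (intro SUP_least INF_greatest) auto
  qed
  moreover have "2 * (?I / 2) = ?I"
    by (simp add: ennreal_times_divide mult.commute[of 2] mult_divide_eq_ennreal)
  ultimately show ?thesis
    by (simp add: GH_dist_def)
qed

end
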